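(* Let $G$ be a finite group, $S$ a subset of $G$, and $\sigma_1,\dots,\sigma_k$ pairwise commuting automorphisms of $G$ of order at most $2$. Assume the Cayley graph $C(G,S)$ is undirected and so is the twisted Cayley graph $C(G,S)^{\sigma_i}$ for every $1\le i\le k$. Suppose the spectrum of $C(G,S)$ contains no sub-multiset of size $\dim L^2(G)-\dim L^2(G)^{\sigma_1=1,\dots,\sigma_k=1}$ which is symmetric about the origin. Then $C(G,S)$ is non-isospectral to at least one of the twisted Cayley graphs $C(G,S)^{\prod_{i\in I}\sigma_i}$, where $I$ runs over the nonempty subsets of $\{1,\dots,k\}$. In particular, $C(G,S)$ is non-isomorphic to one of these twisted Cayley graphs.
   Context: $C(G,S)$ has vertex set $G$ and an edge from $x$ to $xs$ for each $s\in S$; for an automorphism $\tau$ of $G$, the twisted Cayley graph $C(G,S)^\tau$ has vertex set $G$ and an edge from $x$ to $\tau(xs)$ for each $s\in S$. A graph is undirected if its adjacency matrix is symmetric; its spectrum is the multiset of eigenvalues of its adjacency matrix, and two graphs on the same number of vertices are isospectral if their spectra coincide. $L^2(G)$ is the space of complex-valued functions on $G$, and $L^2(G)^{\sigma_1=1,\dots,\sigma_k=1}$ is the subspace of $f$ with $f\circ\sigma_i=f$ for all $i$. A multiset $M$ of complex numbers is symmetric about the origin if $M=-M$. *)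

theory Defs
  imports "HOL-Analysis.Analysis" "HOL-Algebra.Group" "HOL-Computational_Algebra.Fundamental_Theorem_Algebra"
begin

text \<open>Adjacency matrix of the (twisted) Cayley graph C(G,S)^tau: vertex set = carrier of G
 (here the whole finite type 'a), one edge from x to tau(x s) for each s in S.
 The entry (x,y) counts the edges from x to y.  The untwisted Cayley graph is tau = id.\<close>
definition twisted_cayley_adj ::
  "('a::finite, 'b) monoid_scheme \<Rightarrow> 'a set \<Rightarrow> ('a \<Rightarrow> 'a) \<Rightarrow> complex^'a^'a" where
  "twisted_cayley_adj G S tau = (\<chi> x y. of_nat (card {s \<in> S. y = tau (x \<otimes>\<^bsub>G\<^esub> s)}))"

definition cayley_adj :: "('a::finite, 'b) monoid_scheme \<Rightarrow> 'a set \<Rightarrow> complex^'a^'a" where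
  "cayley_adj G S = twisted_cayley_adj G S id"

definition undirected :: "complex^'n^'n \<Rightarrow> bool" where
  "undirected A \<longleftrightarrow> transpose A = A"

definition charpoly :: "complex^'n^'n \<Rightarrow> complex poly" where
  "charpoly A = det (\<chi> i j. (if i = j then [:0, 1:] else 0) - [:A $ i $ j:])"

definition spectrum_mset :: "complex^'n^'n \<Rightarrow> complex multiset" where
  "spectrum_mset A = proots (charpoly A)"

definition isospectral :: "complex^'n^'n \<Rightarrow> complex^'n^'n \<Rightarrow> bool" where
  "isospectral A B \<longleftrightarrow> spectrum_mset A = spectrum_mset B"

definition graph_isomorphic :: "complex^'n^'n \<Rightarrow> complex^'n^'n \<Rightarrow> bool" where
  "graph_isomorphic A B \<longleftrightarrow> (\<exists>p. bij p \<and> (\<forall>x y. B $ p x $ p y = A $ x $ y))"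

definition symmetric_about_origin :: "complex multiset \<Rightarrow> bool" where
  "symmetric_about_origin M \<longleftrightarrow> image_mset uminus M = M"

text \<open>Composite automorphism prod_{i in I} sigma_i (composition in increasing index order;
 the sigma_i commute in the theorem, so the order is irrelevant there).\<close>
definition prod_auto :: "(nat \<Rightarrow> 'a \<Rightarrow> 'a) \<Rightarrow> nat set \<Rightarrow> 'a \<Rightarrow> 'a" where
  "prod_auto \<sigma> I = foldr (\<circ>) (map \<sigma> (sorted_list_of_set I)) id"

text \<open>L^2(G) = functions G -> complex, identified with complex^'a; fixed subspace.\<close>
definition L2_fixed :: "(nat \<Rightarrow> 'a::finite \<Rightarrow> 'a) \<Rightarrow> nat \<Rightarrow> (complex^'a) set" where
  "L2_fixed \<sigma> k = {f. \<forall>i\<in>{1..k}. \<forall>x. f $ (\<sigma> i x) = f $ x}"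

end

theory Submission
  imports Defs
begin

text \<open>Let \<open>A\<close> be the adjacency matrix of \<open>C(G,S)\<close> and \<open>P\<^sub>i\<close> the permutation matrix of \<open>\<sigma> i\<close>, so that the
  twist by \<open>\<sigma> i\<close> has adjacency matrix \<open>A P\<^sub>i\<close>. As \<open>A\<close>, \<open>P\<^sub>i\<close> and \<open>A P\<^sub>i\<close> are symmetric, \<open>A\<close> commutes with
  every \<open>P\<^sub>i\<close>, and a common orthonormal eigenbasis gives eigenvalues \<open>d x\<close> of \<open>A\<close> and signs \<open>e i x\<close>
  of \<open>P\<^sub>i\<close>. The twist by \<open>I\<close> then has spectrum \<open>d x * (\<Prod>i\<in>I. e i x)\<close>. If this is the same
  multiset for all \<open>I\<close>, averaging over \<open>I\<close> shows that the \<open>d x\<close> whose signs are not all \<open>1\<close> form a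
  multiset symmetric about the origin; their number is the codimension of the fixed subspace.\<close>

section \<open>Simultaneous diagonalization of symmetric operators\<close>

text \<open>The quadratic form \<open>x \<bullet> f x\<close> attains its maximum on the compact
  unit sphere of \<open>W\<close>, and a maximizer is an eigenvector whose eigenvalue is the
  maximum.\<close>

lemma self_adjoint_eigenvector:
  fixes f :: "'v::euclidean_space \<Rightarrow> 'v"
  assumes lin: "linear f" and adj: "\<And>x y. f x \<bullet> y = x \<bullet> f y"
    and W: "subspace W" and inv: "\<And>x. x \<in> W \<Longrightarrow> f x \<in> W" and ne: "W \<noteq> {0}"
  obtains v c where "v \<in> W" "v \<noteq> 0" "f v = c *\<^sub>R v"
proof -
  interpret linear f by (rule lin)
  let ?K = "sphere 0 1 \<inter> W"
  have "compact ?K"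
    by (intro compact_Int_closed compact_sphere closed_subspace W)
  moreover obtain w where w: "w \<in> W" "w \<noteq> 0"
    using ne W subspace_0 by blast
  then have "w /\<^sub>R norm w \<in> ?K"
    using W by (auto intro: subspace_scale)
  then have "?K \<noteq> {}" by blast
  moreover have "continuous_on ?K (\<lambda>x. x \<bullet> f x)"
    using linear_continuous_on[of f] lin by (intro continuous_on_inner continuous_on_id)
      (simp add: linear_conv_bounded_linear)
  ultimately have "\<exists>v\<in>?K. \<forall>y\<in>?K. y \<bullet> f y \<le> v \<bullet> f v"
    by (rule continuous_attains_sup)
  then obtain v where v: "v \<in> ?K" and vmax: "\<And>y. y \<in> ?K \<Longrightarrow> y \<bullet> f y \<le> v \<bullet> f v"
    by blast
  define c where "c = v \<bullet> f v"
  have vv: "v \<bullet> v = 1" and vW: "v \<in> W"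
    using v by (auto simp: norm_eq_1)
  \<comment> \<open>Both sides are homogeneous of degree 2, so maximality on the sphere extends to
    all of \<open>W\<close>.\<close>
  have bound: "y \<bullet> f y \<le> c * (y \<bullet> y)" if "y \<in> W" for y
  proof (cases "y = 0")
    case False
    then have "y /\<^sub>R norm y \<in> ?K"
      using W that by (auto intro: subspace_scale)
    from vmax[OF this] have "(y \<bullet> f y) / (norm y * norm y) \<le> c"
      by (simp add: scale c_def field_simps)
    with False show ?thesis
      by (simp add: dot_square_norm power2_eq_square field_simps)
  qed simp
  \<comment> \<open>\<open>u\<close> is the defect in the eigenvector equation and lies in
    \<open>W\<close> by invariance; the goal is \<open>a = 0\<close> for its squared norm
    \<open>a\<close>.\<close>
  define u where "u = f v - c *\<^sub>R v"
  have uW: "u \<in> W"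
    unfolding u_def using W vW inv by (intro subspace_diff subspace_scale) auto
  define a b where "a = u \<bullet> u" and "b = c * (u \<bullet> u) - u \<bullet> f u"
  have b0: "b \<ge> 0" using bound[OF uW] by (simp add: b_def)
  have ua: "u \<bullet> f v = a + c * (u \<bullet> v)"
    by (simp add: a_def u_def algebra_simps)
  \<comment> \<open>First variation: moving from \<open>v\<close> in direction \<open>u\<close>
    changes the form to first order by a multiple of \<open>a\<close>, and maximality bounds this by
    the second-order term.\<close>
  have quad: "2 * t * a \<le> t\<^sup>2 * b" for t
  proof -
    have "v + t *\<^sub>R u \<in> W"
      using W vW uW by (intro subspace_add subspace_scale)
    from bound[OF this]
    have "v \<bullet> f v + t * (v \<bullet> f u) + t * (u \<bullet> f v) + t\<^sup>2 * (u \<bullet> f u)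
        \<le> c * (v \<bullet> v) + 2 * c * t * (u \<bullet> v) + t\<^sup>2 * (c * (u \<bullet> u))"
      by (simp add: add scale algebra_simps power2_eq_square
          inner_commute)
    moreover have "v \<bullet> f u = u \<bullet> f v"
      using adj[of u v] by (metis adj inner_commute)
    ultimately show ?thesis
      using ua vv by (simp add: c_def[symmetric] b_def algebra_simps)
  qed
  have "a = 0"
  proof (rule ccontr)
    assume "a \<noteq> 0"
    then have a: "a > 0" by (simp add: a_def)
    \<comment> \<open>With \<open>t = a / s\<close> the inequality reduces to
      \<open>2 * s \<le> b\<close>; the added 1 keeps \<open>s\<close> positive when
      \<open>b = 0\<close>.\<close>
    define s where "s = b + 1"
    have s: "s > 0" using b0 by (simp add: s_def)
    have "2 * (a / s) * a \<le> (a / s)\<^sup>2 * b" by (rule quad)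
    then have "a\<^sup>2 * (2 * s) \<le> a\<^sup>2 * b"
      using s by (simp add: power2_eq_square field_simps)
    with a have "2 * s \<le> b" by simp
    with b0 show False by (simp add: s_def)
  qed
  then have "f v = c *\<^sub>R v" by (simp add: a_def u_def)
  moreover have "v \<noteq> 0" using vv by auto
  ultimately show ?thesis using vW that by blast
qed

text \<open>Induction on the dimension. If some \<open>f\<close> in \<open>F\<close> is not scalar
  on \<open>W\<close>, then \<open>W\<close> splits into an eigenspace of \<open>f\<close> and its
  orthogonal complement in \<open>W\<close>; both are smaller and invariant under \<open>F\<close>,
  and their bases are joined.\<close>

lemma commuting_self_adjoint_orthonormal_eigenbasis:
  fixes F :: "('v::euclidean_space \<Rightarrow> 'v) set"
  assumes lin: "\<And>f. f \<in> F \<Longrightarrow> linear f"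
    and adj: "\<And>f x y. f \<in> F \<Longrightarrow> f x \<bullet> y = x \<bullet> f y"
    and comm: "\<And>f g x. f \<in> F \<Longrightarrow> g \<in> F \<Longrightarrow> f (g x) = g (f x)"
    and "subspace W" and "\<And>f x. f \<in> F \<Longrightarrow> x \<in> W \<Longrightarrow> f x \<in> W"
  shows "\<exists>B\<subseteq>W. pairwise orthogonal B \<and> (\<forall>x\<in>B. norm x = 1) \<and> card B = dim W
           \<and> (\<forall>f\<in>F. \<forall>x\<in>B. \<exists>c. f x = c *\<^sub>R x)"
  using assms(4,5)
proof (induction "dim W" arbitrary: W rule: less_induct)
  case (less W)
  note W = \<open>subspace W\<close>
  show ?case
  proof (cases "\<forall>f\<in>F. \<exists>c. \<forall>x\<in>W. f x = c *\<^sub>R x")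
    case True
    obtain B where "B \<subseteq> W" "pairwise orthogonal B" "\<And>x. x \<in> B \<Longrightarrow> norm x = 1" "card B = dim W"
      using orthonormal_basis_subspace[OF W] by metis
    with True show ?thesis by blast
  next
    case False
    then obtain f where f: "f \<in> F" and nonscalar: "\<And>c. \<exists>x\<in>W. f x \<noteq> c *\<^sub>R x" by blast
    interpret f: linear f by (rule lin[OF f])
    have "W \<noteq> {0}" using nonscalar by auto
    then obtain v c where v: "v \<in> W" "v \<noteq> 0" "f v = c *\<^sub>R v"
      using self_adjoint_eigenvector[OF lin[OF f] adj[OF f] W] less.prems(2) f by metis
    define U where "U = {x \<in> W. f x = c *\<^sub>R x}"
    define U' where "U' = {y \<in> W. \<forall>x\<in>U. orthogonal x y}"
    have U: "subspace U" "U \<subseteq> W"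
      using W by (auto simp: U_def subspace_def f.add f.scale algebra_simps)
    have U': "subspace U'" "U' \<subseteq> W"
      using W by (auto simp: U'_def subspace_def orthogonal_clauses)
    have dims: "dim U' + dim U = dim W"
      unfolding U'_def by (rule dim_subspace_orthogonal_to_vectors[OF U(1) W U(2)])
    \<comment> \<open>Both pieces are proper: \<open>U\<close> contains \<open>v\<close>, so its
      complement is smaller than \<open>W\<close>, and \<open>U = W\<close> would make
      \<open>f\<close> scalar on \<open>W\<close>.\<close>
    have "dim U \<noteq> 0"
      using v by (auto simp: U_def)
    then have lt': "dim U' < dim W" using dims by linarith
    have "U \<noteq> W" using nonscalar[of c] by (auto simp: U_def)
    then have lt: "dim U < dim W"
      using subspace_dim_equal[OF U(1) W U(2)] by linarith
    \<comment> \<open>Commuting with \<open>f\<close> preserves its eigenspaces; self-adjointness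
      then carries invariance over to the orthogonal complement.\<close>
    have invU: "g x \<in> U" if "g \<in> F" "x \<in> U" for g x
      using that comm[OF f that(1), of x] less.prems(2)[OF that(1), of x] lin[OF that(1)]
      by (auto simp: U_def linear_scale)
    have invU': "g y \<in> U'" if "g \<in> F" "y \<in> U'" for g y
      using that invU[OF that(1)] less.prems(2)[OF that(1), of y] adj[OF that(1)]
      by (auto simp: U'_def orthogonal_def) metis
    obtain B where B: "B \<subseteq> U" "pairwise orthogonal B" "\<forall>x\<in>B. norm x = 1" "card B = dim U"
        "\<forall>f\<in>F. \<forall>x\<in>B. \<exists>c. f x = c *\<^sub>R x"
      using less.hyps[OF lt U(1)] invU by metis
    obtain B' where B': "B' \<subseteq> U'" "pairwise orthogonal B'" "\<forall>x\<in>B'. norm x = 1" "card B' = dim U'"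
        "\<forall>f\<in>F. \<forall>x\<in>B'. \<exists>c. f x = c *\<^sub>R x"
      using less.hyps[OF lt' U'(1)] invU' by metis
    have orth: "orthogonal x y" if "x \<in> B" "y \<in> B'" for x y
      using that B(1) B'(1) by (auto simp: U'_def)
    have "B \<inter> B' = {}"
    proof (rule ccontr)
      assume "B \<inter> B' \<noteq> {}"
      then obtain x where "x \<in> B" "x \<in> B'" by blast
      with orth[of x x] B(3) show False by (auto simp: orthogonal_self)
    qed
    moreover have "finite B" "finite B'"
      using B(2) B'(2) pairwise_orthogonal_imp_finite by blast+
    ultimately have "card (B \<union> B') = dim W"
      using dims B(4) B'(4) by (simp add: card_Un_disjoint)
    moreover have "pairwise orthogonal (B \<union> B')"
      using B(2) B'(2) orth orthogonal_commute unfolding pairwise_def by blast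
    ultimately show ?thesis
      using B B' U(2) U'(2) by (intro exI[of _ "B \<union> B'"]) blast
  qed
qed

section \<open>Diagonal matrices and simultaneous diagonalization in matrix form\<close>

definition diag_mat :: "('n \<Rightarrow> 'a::zero) \<Rightarrow> 'a^'n^'n" where
  "diag_mat d = (\<chi> i j. if i = j then d i else 0)"

lemma diag_mat_mult [simp]:
  fixes d e :: "'n::finite \<Rightarrow> 'a::semiring_1"
  shows "diag_mat d ** diag_mat e = diag_mat (\<lambda>i. d i * e i)"
proof -
  have "(\<Sum>k\<in>UNIV. (if i = k then d i else 0) * (if k = j then e k else 0))
      = (\<Sum>k\<in>UNIV. if k = i then (if i = j then d i * e i else 0) else 0)" for i j
    by (rule sum.cong) auto
  then show ?thesis
    by (simp add: diag_mat_def matrix_matrix_mult_def vec_eq_iff)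
qed

lemma diag_mat_vector_mult [simp]:
  fixes d :: "'n::finite \<Rightarrow> 'a::semiring_1"
  shows "(diag_mat d *v x) $ i = d i * x $ i"
proof -
  have "(\<Sum>j\<in>UNIV. (if i = j then d i else 0) * x $ j)
      = (\<Sum>j\<in>UNIV. if j = i then d i * x $ i else 0)"
    by (rule sum.cong) auto
  then show ?thesis
    by (simp add: diag_mat_def matrix_vector_mult_def)
qed

text \<open>The columns of \<open>V\<close> are a common orthonormal eigenbasis, so one
  \<open>V\<close> serves the whole family and only the diagonal depends on
  \<open>M\<close>.\<close>

lemma commuting_symmetric_matrices_diagonalizable:
  fixes F :: "(real^'n^'n) set"
  assumes sym: "\<And>M. M \<in> F \<Longrightarrow> transpose M = M"
    and comm: "\<And>M N. M \<in> F \<Longrightarrow> N \<in> F \<Longrightarrow> M ** N = N ** M"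
  obtains V where "orthogonal_matrix V"
    and "\<And>M. M \<in> F \<Longrightarrow> \<exists>d. M = V ** diag_mat d ** transpose V"
proof -
  have "\<exists>B\<subseteq>(UNIV :: (real^'n) set). pairwise orthogonal B \<and> (\<forall>x\<in>B. norm x = 1)
      \<and> card B = dim (UNIV :: (real^'n) set)
      \<and> (\<forall>f\<in>(*v) ` F. \<forall>x\<in>B. \<exists>c. f x = c *\<^sub>R x)"
  proof (rule commuting_self_adjoint_orthonormal_eigenbasis)
    fix f g x assume "f \<in> (*v) ` F" "g \<in> (*v) ` F"
    then show "f (g x) = g (f x)"
      using comm by (auto simp: matrix_vector_mul_assoc)
  next
    fix f x y assume "f \<in> (*v) ` F"
    then show "f x \<bullet> y = x \<bullet> f y"
      using sym by (auto simp: dot_lmul_matrix[symmetric] inner_commute)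
         (metis dot_lmul_matrix inner_commute transpose_matrix_vector)
  qed auto
  then obtain B :: "(real^'n) set" where B: "pairwise orthogonal B" "\<forall>x\<in>B. norm x = 1"
      "card B = CARD('n)" "\<forall>M\<in>F. \<forall>x\<in>B. \<exists>c. M *v x = c *\<^sub>R x"
    by auto
  then have "finite B" by (metis card.infinite zero_less_card_finite less_irrefl)
  with B(3) obtain b where b: "bij_betw b (UNIV :: 'n set) B"
    using finite_same_card_bij by (metis finite)
  define V where "V = (\<chi> i j. b j $ i)"
  have col: "column j V = b j" for j
    by (simp add: V_def column_def)
  have bB: "b j \<in> B" for j using b bij_betw_apply by fastforce
  have "b i \<noteq> b j" if "i \<noteq> j" for i j
    using that b by (auto simp: bij_betw_def inj_on_def)
  then have V: "orthogonal_matrix V"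
    using B(1,2) bB by (auto simp: orthogonal_matrix_orthonormal_columns col pairwise_def)
  have "\<exists>d. M = V ** diag_mat d ** transpose V" if "M \<in> F" for M
  proof -
    have "\<forall>j. \<exists>c. M *v b j = c *\<^sub>R b j" using B(4) bB that by blast
    then obtain d where d: "\<And>j. M *v b j = d j *\<^sub>R b j" by metis
    have "column j (M ** V) = column j (V ** diag_mat d)" for j
    proof -
      have "(\<Sum>k\<in>UNIV. b k $ i * (if k = j then d k else 0)) = b j $ i * d j" for i
      proof -
        have "(\<Sum>k\<in>UNIV. b k $ i * (if k = j then d k else 0))
          = (\<Sum>k\<in>UNIV. if k = j then b j $ i * d j else 0)"
          by (rule sum.cong) auto
        then show ?thesis by simp
      qed
      then have "column j (V ** diag_mat d) = d j *\<^sub>R b j"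
        by (simp add: vec_eq_iff column_def V_def diag_mat_def matrix_matrix_mult_def mult.commute)
      moreover have "column j (M ** V) = M *v b j"
        by (simp add: vec_eq_iff column_def V_def matrix_matrix_mult_def matrix_vector_mult_def)
      ultimately show ?thesis by (simp add: d)
    qed
    then have "M ** V = V ** diag_mat d"
      by (simp add: vec_eq_iff column_def)
    then have "M ** (V ** transpose V) = V ** diag_mat d ** transpose V"
      by (simp add: matrix_mul_assoc)
    then show ?thesis
      using V by (auto simp: orthogonal_matrix_def)
  qed
  with V that show ?thesis by blast
qed

section \<open>Spectra\<close>

lemma map_matrix_of_real_mult:
  fixes A :: "real^'n^'m" and B :: "real^'k^'n"
  shows "map_matrix complex_of_real (A ** B) = map_matrix of_real A ** map_matrix of_real B"
  by (simp add: vec_eq_iff matrix_matrix_mult_def)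

text \<open>Embedding scalars as constant polynomials is a ring homomorphism; this lifts matrix
  identities to the polynomial matrices whose determinant is \<open>charpoly\<close>.\<close>

lemma map_matrix_const_poly_mult:
  fixes A :: "complex^'n^'m" and B :: "complex^'k^'n"
  shows "map_matrix (\<lambda>c. [:c:]) (A ** B) = map_matrix (\<lambda>c. [:c:]) A ** map_matrix (\<lambda>c. [:c:]) B"
proof -
  have "(\<Sum>k\<in>K. [:f k:]) = [:\<Sum>k\<in>K. f k:]" for f :: "'n \<Rightarrow> complex" and K
    by (induction K rule: infinite_finite_induct) auto
  then show ?thesis
    by (simp add: vec_eq_iff matrix_matrix_mult_def mult_ac)
qed

lemma matrix_diff_ldistrib:
  fixes A :: "'a::ring_1^'n^'m"
  shows "A ** (B - C) = A ** B - A ** C"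
  by (simp add: vec_eq_iff matrix_matrix_mult_def right_diff_distrib sum_subtractf)

lemma matrix_diff_rdistrib:
  fixes A :: "'a::ring_1^'n^'m"
  shows "(A - B) ** C = A ** C - B ** C"
  by (simp add: vec_eq_iff matrix_matrix_mult_def left_diff_distrib sum_subtractf)

lemma charpoly_alt: "charpoly A = det (diag_mat (\<lambda>_. [:0, 1:]) - map_matrix (\<lambda>c. [:c:]) A)"
  unfolding charpoly_def diag_mat_def by (rule arg_cong[of _ _ det]) (simp add: vec_eq_iff)

text \<open>Over the polynomial ring the scalar matrix \<open>?X\<close> commutes with the lift of
  \<open>U\<close>, so the whole characteristic matrix is conjugated, and the determinants of the
  two outer factors multiply to 1.\<close>

lemma charpoly_similar:
  fixes A U U' :: "complex^'n^'n"
  assumes "U ** U' = mat 1"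
  shows "charpoly (U ** A ** U') = charpoly A"
proof -
  let ?C = "map_matrix (\<lambda>c::complex. [:c:])" and ?X = "diag_mat (\<lambda>_. [:0, 1::complex:])"
  have 1: "?C U ** ?C U' = mat 1"
    by (simp flip: map_matrix_const_poly_mult add: assms)
       (simp add: vec_eq_iff mat_def one_pCons)
  have X: "?C U ** ?X = ?X ** ?C U"
  proof -
    have "(\<Sum>k\<in>UNIV. [:U $ i $ k:] * (if k = j then [:0, 1:] else 0))
        = (\<Sum>k\<in>UNIV. if k = j then [:0, U $ i $ j:] else 0)" for i j
      by (rule sum.cong) auto
    moreover have "(\<Sum>k\<in>UNIV. (if i = k then [:0, 1:] else 0) * [:U $ k $ j:])
        = (\<Sum>k\<in>UNIV. if k = i then [:0, U $ i $ j:] else 0)" for i j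
      by (rule sum.cong) auto
    ultimately show ?thesis
      by (simp add: vec_eq_iff matrix_matrix_mult_def diag_mat_def)
  qed
  have "?X - ?C (U ** A ** U') = ?C U ** (?X - ?C A) ** ?C U'"
    by (simp add: map_matrix_const_poly_mult matrix_diff_ldistrib matrix_diff_rdistrib X)
       (simp add: 1 flip: matrix_mul_assoc)
  then have "charpoly (U ** A ** U') = det (?C U) * charpoly A * det (?C U')"
    by (simp add: charpoly_alt det_mul)
  moreover have "det (?C U) * det (?C U') = 1"
    by (simp flip: det_mul add: 1)
  ultimately show ?thesis by (metis mult.assoc mult.commute mult.right_neutral)
qed

lemma charpoly_diag_mat: "charpoly (diag_mat d) = (\<Prod>i\<in>UNIV. [:- d i, 1:])"
  unfolding charpoly_def by (subst det_diagonal) (auto simp: diag_mat_def)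

lemma spectrum_mset_diagonalized:
  fixes U U' :: "complex^'n^'n"
  assumes "U ** U' = mat 1"
  shows "spectrum_mset (U ** diag_mat d ** U') = image_mset d (mset_set UNIV)"
proof -
  have "(\<Sum>i\<in>A. {#d i#}) = image_mset d (mset_set A)" if "finite A" for A
    using that by induction auto
  then show ?thesis
    by (simp add: spectrum_mset_def charpoly_similar[OF assms] charpoly_diag_mat proots_prod)
qed

text \<open>Relabelling vertices permutes rows and columns of the characteristic matrix alike, so
  the sign of the permutation enters the determinant twice and cancels.\<close>

lemma graph_isomorphic_imp_isospectral:
  assumes "graph_isomorphic A B"
  shows "isospectral A B"
proof -
  obtain p where p: "bij p" and B: "\<And>x y. B $ p x $ p y = A $ x $ y"
    using assms by (auto simp: graph_isomorphic_def)
  then have perm: "p permutes UNIV" by (simp add: permutes_univ bij_iff)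
  define N where "N = (\<chi> i j. (if i = j then [:0, 1:] else 0) - [:B $ i $ j:])"
  have "charpoly A = det (\<chi> i j. N $ p i $ p j)"
    unfolding charpoly_def N_def by (simp add: B inj_eq[OF bij_is_inj[OF p]])
  also have "\<dots> = of_int (sign p) * (of_int (sign p) * det N)"
    using det_permute_rows[OF perm, of "\<chi> i j. N $ i $ p j"] det_permute_columns[OF perm, of N]
    by simp
  also have "\<dots> = det N"
    by (simp add: sign_def)
  finally show ?thesis
    by (simp add: isospectral_def spectrum_mset_def charpoly_def N_def)
qed

text \<open>Test the hypothesis against odd functions \<open>f\<close>: since \<open>f (\<plusminus> z) = \<plusminus> f z\<close>, summing over all
  \<open>I\<close> produces the factor \<open>\<Prod>i\<in>K. (1 + e i x)\<close>, which vanishes unless every \<open>e i x\<close> is 1.\<close>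
lemma sign_twists_symmetric:
  fixes d :: "'a::finite \<Rightarrow> complex" and e :: "'i \<Rightarrow> 'a \<Rightarrow> complex"
  assumes K: "finite K" and e: "\<And>i x. i \<in> K \<Longrightarrow> e i x \<in> {1, -1}"
    and iso: "\<And>I. I \<subseteq> K \<Longrightarrow>
      image_mset (\<lambda>x. d x * (\<Prod>i\<in>I. e i x)) (mset_set UNIV) = image_mset d (mset_set UNIV)"
  shows "symmetric_about_origin (image_mset d (mset_set {x. \<exists>i\<in>K. e i x \<noteq> 1}))"
proof -
  let ?T = "{x. \<exists>i\<in>K. e i x \<noteq> 1}"
  let ?M = "image_mset d (mset_set ?T)"
  have "count ?M c = count ?M (- c)" for c
  proof -
    \<comment> \<open>The sum of this odd function over a multiset is the multiplicity of
      \<open>c\<close> minus that of \<open>- c\<close>; for \<open>c = 0\<close> it is identically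
      zero.\<close>
    define f :: "complex \<Rightarrow> complex" where
      "f z = (if z = c then 1 else 0) - (if z = - c then 1 else 0)" for z
    have f_odd: "f (z * s) = f z * s" if "s \<in> {1, -1}" for z s
      using that by (auto simp: f_def minus_equation_iff)
    have sgn: "(\<Prod>i\<in>I. e i x) \<in> {1, -1}" if "I \<subseteq> K" for I x
      using finite_subset[OF that K] that
    proof (induction I)
      case (insert i I)
      then show ?case using e[of i x] by auto
    qed auto
    have tw: "(\<Sum>x\<in>UNIV. f (d x) * (\<Prod>i\<in>I. e i x)) = (\<Sum>x\<in>UNIV. f (d x))" if "I \<subseteq> K" for I
    proof -
      have "(\<Sum>x\<in>UNIV. f (d x) * (\<Prod>i\<in>I. e i x)) = (\<Sum>x\<in>UNIV. f (d x * (\<Prod>i\<in>I. e i x)))"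
        using f_odd sgn[OF that] by simp
      also have "\<dots> = sum_mset (image_mset f (image_mset (\<lambda>x. d x * (\<Prod>i\<in>I. e i x)) (mset_set UNIV)))"
        by (simp add: sum_unfold_sum_mset multiset.map_comp o_def)
      also have "\<dots> = (\<Sum>x\<in>UNIV. f (d x))"
        by (subst iso[OF that]) (simp add: sum_unfold_sum_mset multiset.map_comp o_def)
      finally show ?thesis .
    qed
    have "(\<Sum>I\<in>Pow K. \<Prod>i\<in>I. e i x) = (\<Prod>i\<in>K. 1 + e i x)" for x
      using prod_add[OF K, of "\<lambda>i. e i x" "\<lambda>_. 1"] by (simp add: add.commute)
    also have "(\<Prod>i\<in>K. 1 + e i x) = (if x \<in> ?T then 0 else 2 ^ card K)" for x
    proof (cases "x \<in> ?T")
      case True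
      then obtain i where "i \<in> K" "e i x \<noteq> 1" by auto
      with e[of i x] have "i \<in> K" "1 + e i x = 0" by auto
      with True K show ?thesis by auto
    qed auto
    finally have avg: "(\<Sum>I\<in>Pow K. \<Prod>i\<in>I. e i x) = (if x \<in> ?T then 0 else 2 ^ card K)" for x .
    \<comment> \<open>Each of the \<open>2 ^ card K\<close> subsets gives the same sum by
      \<open>tw\<close>; after exchanging the sums only the \<open>x\<close> outside
      \<open>?T\<close> survive, with the same factor, so the part over \<open>?T\<close> must be
      0.\<close>
    have "2 ^ card K * (\<Sum>x\<in>UNIV. f (d x))
        = (\<Sum>I\<in>Pow K. \<Sum>x\<in>UNIV. f (d x) * (\<Prod>i\<in>I. e i x))"
      using tw K by (simp add: card_Pow)
    also have "\<dots> = (\<Sum>x\<in>UNIV. f (d x) * (\<Sum>I\<in>Pow K. \<Prod>i\<in>I. e i x))"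
      by (subst sum.swap) (simp add: sum_distrib_left)
    also have "\<dots> = 2 ^ card K * (\<Sum>x\<in>-?T. f (d x))"
      unfolding avg sum_distrib_left by (rule sum.mono_neutral_cong_right) auto
    finally have "(\<Sum>x\<in>UNIV. f (d x)) = (\<Sum>x\<in>-?T. f (d x))" by simp
    moreover have "(\<Sum>x\<in>UNIV. f (d x)) = (\<Sum>x\<in>?T. f (d x)) + (\<Sum>x\<in>-?T. f (d x))"
      by (subst sum.union_disjoint[symmetric]) (auto intro: sum.cong)
    ultimately have "(\<Sum>x\<in>?T. f (d x)) = 0" by simp
    moreover have "of_nat (count ?M z) = (\<Sum>x\<in>?T. if d x = z then 1 else (0::complex))" for z
      by (simp add: count_image_mset sum.If_cases vimage_def Int_def conj_commute)
    ultimately have "(of_nat (count ?M c) :: complex) = of_nat (count ?M (- c))"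
      by (simp add: f_def sum_subtractf)
    then show ?thesis by (simp only: of_nat_eq_iff)
  qed
  moreover have "count (image_mset uminus N) c = count N (- c)" for N :: "complex multiset" and c
    by (induction N) (auto simp: minus_equation_iff)
  ultimately show ?thesis
    unfolding symmetric_about_origin_def by (intro multiset_eqI) simp
qed

section \<open>Twisted Cayley graphs\<close>

text \<open>Oriented so that it acts on functions by \<open>f \<mapsto> f \<circ> \<tau>\<close>:
  the common fixed vectors of these matrices form \<open>L2_fixed\<close>, and matrix products
  reverse composition.\<close>

definition perm_mat :: "('a \<Rightarrow> 'a) \<Rightarrow> 'b::zero_neq_one^'a^'a" where
  "perm_mat \<tau> = (\<chi> x y. if \<tau> x = y then 1 else 0)"

lemma perm_mat_vector_mult [simp]:
  fixes f :: "'b::semiring_1^'a::finite"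
  shows "(perm_mat \<tau> *v f) $ x = f $ \<tau> x"
proof -
  have "(\<Sum>y\<in>UNIV. (if \<tau> x = y then 1 else 0) * f $ y) = (\<Sum>y\<in>UNIV. if y = \<tau> x then f $ \<tau> x else 0)"
    by (rule sum.cong) auto
  then show ?thesis
    by (simp add: perm_mat_def matrix_vector_mult_def)
qed

lemma mult_perm_mat_involution:
  fixes A :: "'b::semiring_1^'a^'c"
  assumes "\<tau> \<circ> \<tau> = id"
  shows "(A ** perm_mat \<tau>) $ x $ y = A $ x $ \<tau> y"
proof -
  have "\<tau> z = y \<longleftrightarrow> z = \<tau> y" for z using assms by (metis id_apply o_apply)
  then have "(\<Sum>z\<in>UNIV. A $ x $ z * (if \<tau> z = y then 1 else 0))
      = (\<Sum>z\<in>UNIV. if z = \<tau> y then A $ x $ \<tau> y else 0)"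
    by (intro sum.cong) auto
  then show ?thesis
    by (simp add: perm_mat_def matrix_matrix_mult_def)
qed

lemma perm_mat_mult:
  "perm_mat \<tau> ** perm_mat \<rho> = (perm_mat (\<rho> \<circ> \<tau>) :: 'b::semiring_1^'a::finite^'a)"
  by (subst matrix_eq) (simp add: vec_eq_iff flip: matrix_vector_mul_assoc)

text \<open>Applying \<open>\<tau>\<close> last only moves the endpoints of edges, which permutes
  the columns by the inverse of \<open>\<tau>\<close>, here \<open>\<tau>\<close> itself.\<close>

lemma twisted_cayley_adj_comp:
  assumes "\<tau> \<circ> \<tau> = id"
  shows "twisted_cayley_adj G S (\<tau> \<circ> \<rho>) = twisted_cayley_adj G S \<rho> ** perm_mat \<tau>"
proof -
  have "y = \<tau> z \<longleftrightarrow> \<tau> y = z" for y z using assms by (metis id_apply o_apply)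
  then show ?thesis
    by (simp add: vec_eq_iff mult_perm_mat_involution[OF assms]) (simp add: twisted_cayley_adj_def)
qed

theorem theorem4p7:
  fixes G :: "('a::finite, 'b) monoid_scheme"
    and S :: "'a set"
    and \<sigma> :: "nat \<Rightarrow> 'a \<Rightarrow> 'a"
    and k :: nat
  assumes grp: "group G"
    and carr: "carrier G = UNIV"
    and aut: "\<And>i. i \<in> {1..k} \<Longrightarrow> \<sigma> i \<in> iso G G"
    and ord2: "\<And>i. i \<in> {1..k} \<Longrightarrow> \<sigma> i \<circ> \<sigma> i = id"
    and comm: "\<And>i j. i \<in> {1..k} \<Longrightarrow> j \<in> {1..k} \<Longrightarrow> \<sigma> i \<circ> \<sigma> j = \<sigma> j \<circ> \<sigma> i"
    and und: "undirected (cayley_adj G S)"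
    and und_tw: "\<And>i. i \<in> {1..k} \<Longrightarrow> undirected (twisted_cayley_adj G S (\<sigma> i))"
    and nosym: "\<not> (\<exists>M. M \<subseteq># spectrum_mset (cayley_adj G S)
                  \<and> size M = vec.dim (UNIV :: (complex^'a) set) - vec.dim (L2_fixed \<sigma> k)
                  \<and> symmetric_about_origin M)"
  shows "\<exists>I. I \<subseteq> {1..k} \<and> I \<noteq> {}
           \<and> \<not> isospectral (cayley_adj G S) (twisted_cayley_adj G S (prod_auto \<sigma> I))
           \<and> \<not> graph_isomorphic (cayley_adj G S) (twisted_cayley_adj G S (prod_auto \<sigma> I))"
proof (rule ccontr)
  assume "\<not> ?thesis"
  \<comment> \<open>Isomorphic graphs are isospectral, so a nonempty \<open>I\<close> with different
    spectra would satisfy both negated clauses at once.\<close>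
  then have iso: "isospectral (cayley_adj G S) (twisted_cayley_adj G S (prod_auto \<sigma> I))"
    if "I \<subseteq> {1..k}" "I \<noteq> {}" for I
    using that graph_isomorphic_imp_isospectral by blast

  \<comment> \<open>Commuting real symmetric matrices of the graph and the automorphisms\<close>
  let ?c = "map_matrix complex_of_real"
  \<comment> \<open>All entries are real, so diagonalization takes place over the reals and
    \<open>?c\<close> carries the result back to the complex matrices.\<close>
  define A :: "real^'a^'a" where "A = (\<chi> x y. of_nat (card {s \<in> S. y = x \<otimes>\<^bsub>G\<^esub> s}))"
  define P :: "nat \<Rightarrow> real^'a^'a" where "P i = perm_mat (\<sigma> i)" for i
  have cA: "?c A = cayley_adj G S"
    by (simp add: A_def cayley_adj_def twisted_cayley_adj_def vec_eq_iff)
  have cP: "?c (P i) = perm_mat (\<sigma> i)" for i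
    by (simp add: P_def perm_mat_def vec_eq_iff)
  have inj_c: "M = N" if "?c M = ?c N" for M N :: "real^'a^'a"
    using that by (simp add: vec_eq_iff)
  have c_transpose: "?c (transpose M) = transpose (?c M)" for M :: "real^'a^'a"
    by (simp add: vec_eq_iff transpose_def)
  have A_sym: "transpose A = A"
    using und by (intro inj_c) (simp add: c_transpose cA undirected_def)
  have P_sym: "transpose (P i) = P i" if "i \<in> {1..k}" for i
    using ord2[OF that] by (auto simp: P_def perm_mat_def vec_eq_iff transpose_def)
      (metis id_apply o_apply)+
  have tw: "twisted_cayley_adj G S (\<sigma> i \<circ> \<rho>) = twisted_cayley_adj G S \<rho> ** ?c (P i)"
    if "i \<in> {1..k}" for i \<rho>
    using twisted_cayley_adj_comp[OF ord2[OF that]] by (simp add: cP)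
  \<comment> \<open>Undirectedness of the twist says that \<open>A ** P i\<close> is symmetric;
    since both factors are symmetric, its transpose is \<open>P i ** A\<close>.\<close>
  have AP: "A ** P i = P i ** A" if i: "i \<in> {1..k}" for i
  proof -
    have "twisted_cayley_adj G S (\<sigma> i) = ?c (A ** P i)"
      using tw[OF i, of id] by (simp add: map_matrix_of_real_mult cA cayley_adj_def)
    then have "transpose (A ** P i) = A ** P i"
      using und_tw[OF i] by (intro inj_c) (simp add: c_transpose undirected_def)
    then show ?thesis
      by (simp add: matrix_transpose_mul A_sym P_sym[OF i])
  qed
  have PP: "P i ** P j = P j ** P i" if "i \<in> {1..k}" "j \<in> {1..k}" for i j
    using comm[OF that] by (simp add: P_def perm_mat_mult)
  obtain V where V: "orthogonal_matrix V"
    and diag: "\<And>M. M \<in> insert A (P ` {1..k}) \<Longrightarrow> \<exists>d. M = V ** diag_mat d ** transpose V"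
    by (rule commuting_symmetric_matrices_diagonalizable[of "insert A (P ` {1..k})"])
       (use A_sym P_sym AP PP in auto)

  \<comment> \<open>Eigenvalues and signs in the common eigenbasis\<close>
  define U where "U = ?c V"
  define U' where "U' = ?c (transpose V)"
  have "?c (mat 1) = mat 1"
    by (simp add: vec_eq_iff mat_def)
  then have UU: "U ** U' = mat 1" "U' ** U = mat 1"
    using V by (simp_all add: U_def U'_def orthogonal_matrix_def flip: map_matrix_of_real_mult)
  have c_diag: "?c (V ** diag_mat d ** transpose V) = U ** diag_mat (\<lambda>x. of_real (d x)) ** U'" for d
  proof -
    have "?c (diag_mat d) = diag_mat (\<lambda>x. of_real (d x))"
      by (simp add: vec_eq_iff diag_mat_def)
    then show ?thesis by (simp add: map_matrix_of_real_mult U_def U'_def)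
  qed
  obtain d where d: "cayley_adj G S = U ** diag_mat d ** U'"
    using diag[of A] c_diag cA by (metis insertI1)
  have "\<exists>e. ?c (P i) = U ** diag_mat e ** U'" if "i \<in> {1..k}" for i
    using diag[of "P i"] c_diag that by (metis image_eqI insertI2)
  then obtain e where e: "\<And>i. i \<in> {1..k} \<Longrightarrow> ?c (P i) = U ** diag_mat (e i) ** U'"
    by metis
  have mult: "(U ** diag_mat f ** U') ** (U ** diag_mat g ** U') = U ** diag_mat (\<lambda>x. f x * g x) ** U'"
    for f g
  proof -
    have "(U ** diag_mat f ** U') ** (U ** diag_mat g ** U')
        = U ** diag_mat f ** (U' ** U) ** diag_mat g ** U'"
      by (simp add: matrix_mul_assoc)
    also have "\<dots> = U ** (diag_mat f ** diag_mat g) ** U'"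
      by (simp only: UU matrix_mul_rid) (simp only: matrix_mul_assoc)
    finally show ?thesis by simp
  qed
  have conj: "diag_mat f = U' ** (U ** diag_mat f ** U') ** U" for f
    by (simp add: matrix_mul_assoc UU) (simp add: UU flip: matrix_mul_assoc)
  \<comment> \<open>The involution \<open>\<sigma> i\<close> gives \<open>P i\<close> square 1, and
    undoing the conjugation gives every \<open>e i x\<close> square 1.\<close>
  have e_sq: "e i x \<in> {1, -1}" if i: "i \<in> {1..k}" for i x
  proof -
    have "P i ** P i = mat 1"
      using ord2[OF i] by (simp add: P_def perm_mat_mult) (simp add: perm_mat_def mat_def)
    then have "?c (P i) ** ?c (P i) = mat 1"
      using \<open>?c (mat 1) = mat 1\<close> by (simp flip: map_matrix_of_real_mult)
    then have "U ** diag_mat (\<lambda>x. e i x * e i x) ** U' = mat 1"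
      by (simp add: e[OF i] mult)
    then have "diag_mat (\<lambda>x. e i x * e i x) = mat 1"
      using conj[of "\<lambda>x. e i x * e i x"] by (simp add: UU)
    then have "e i x * e i x = 1"
      by (simp add: vec_eq_iff diag_mat_def mat_def) metis
    then show ?thesis by (simp add: square_eq_1_iff)
  qed
  \<comment> \<open>The induction follows the fold in \<open>prod_auto\<close>: each automorphism
    composed on the left contributes a right factor \<open>P i\<close>, that is, a factor
    \<open>e i x\<close> on the diagonal.\<close>
  have tw_list: "twisted_cayley_adj G S (foldr (\<circ>) (map \<sigma> xs) id)
      = U ** diag_mat (\<lambda>x. d x * (\<Prod>i\<leftarrow>xs. e i x)) ** U'" if "set xs \<subseteq> {1..k}" for xs
    using that
  proof (induction xs)
    case Nil
    then show ?case using d by (simp add: cayley_adj_def id_def)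
  next
    case (Cons i xs)
    then have i: "i \<in> {1..k}" and xs: "set xs \<subseteq> {1..k}" by auto
    have "twisted_cayley_adj G S (foldr (\<circ>) (map \<sigma> (i # xs)) id)
        = twisted_cayley_adj G S (foldr (\<circ>) (map \<sigma> xs) id) ** ?c (P i)"
      using tw[OF i] by simp
    then show ?case
      by (simp only: Cons.IH[OF xs] e[OF i] mult list.map prod_list.Cons mult_ac)
  qed
  have tw_set: "twisted_cayley_adj G S (prod_auto \<sigma> I)
      = U ** diag_mat (\<lambda>x. d x * (\<Prod>i\<in>I. e i x)) ** U'" if "I \<subseteq> {1..k}" for I
  proof -
    have "finite I" using that finite_subset by blast
    then show ?thesis
      using tw_list[of "sorted_list_of_set I"] that
      by (simp add: prod_auto_def prod.distinct_set_conv_list[symmetric])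
  qed

  \<comment> \<open>The forbidden symmetric sub-multiset and its size\<close>
  let ?T = "{x. \<exists>i\<in>{1..k}. e i x \<noteq> 1}"
  let ?M = "image_mset d (mset_set ?T)"
  have spec: "spectrum_mset (cayley_adj G S) = image_mset d (mset_set UNIV)"
    unfolding d by (rule spectrum_mset_diagonalized[OF UU(1)])
  have "symmetric_about_origin ?M"
  proof (rule sign_twists_symmetric)
    fix I assume I: "I \<subseteq> {1..k}"
    show "image_mset (\<lambda>x. d x * (\<Prod>i\<in>I. e i x)) (mset_set UNIV) = image_mset d (mset_set UNIV)"
    proof (cases "I = {}")
      case False
      with iso[OF I] show ?thesis
        by (simp add: isospectral_def spec tw_set[OF I] spectrum_mset_diagonalized[OF UU(1)])
    qed simp
  qed (use e_sq in auto)
  moreover have "?M \<subseteq># spectrum_mset (cayley_adj G S)"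
    unfolding spec by (intro image_mset_subseteq_mono) (simp add: subset_imp_msubset_mset_set)
  moreover have "size ?M = vec.dim (UNIV :: (complex^'a) set) - vec.dim (L2_fixed \<sigma> k)"
  proof -
    let ?E = "{g :: complex^'a. \<forall>x. x \<notin> -?T \<longrightarrow> g $ x = 0}"
    \<comment> \<open>In eigenbasis coordinates each \<open>P i\<close> scales coordinate
      \<open>x\<close> by \<open>e i x\<close>, so a fixed vector is one whose coordinates vanish on
      \<open>?T\<close>.\<close>
    have fixed: "f \<in> L2_fixed \<sigma> k \<longleftrightarrow> U' *v f \<in> ?E" for f
    proof -
      have "f \<in> L2_fixed \<sigma> k \<longleftrightarrow> (\<forall>i\<in>{1..k}. ?c (P i) *v f = f)"
        by (simp add: L2_fixed_def cP vec_eq_iff)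
      also have "\<dots> \<longleftrightarrow> (\<forall>i\<in>{1..k}. diag_mat (e i) *v (U' *v f) = U' *v f)"
      proof (intro ball_cong refl)
        fix i assume i: "i \<in> {1..k}"
        have "U' *v (?c (P i) *v f) = diag_mat (e i) *v (U' *v f)"
          unfolding e[OF i] matrix_vector_mul_assoc by (simp add: matrix_mul_assoc UU)
        moreover have "U *v (U' *v g) = g" for g
          by (simp add: matrix_vector_mul_assoc UU)
        ultimately show "?c (P i) *v f = f \<longleftrightarrow> diag_mat (e i) *v (U' *v f) = U' *v f"
          by metis
      qed
      also have "\<dots> \<longleftrightarrow> U' *v f \<in> ?E"
        by (auto simp: vec_eq_iff)
      finally show ?thesis .
    qed
    have inverse: "U' *v (U *v g) = g" for g
      by (simp add: matrix_vector_mul_assoc UU)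
    \<comment> \<open>The invertible \<open>U\<close> identifies the fixed space with a coordinate
      subspace of dimension \<open>card (- ?T)\<close>, so its codimension is
      \<open>card ?T\<close>, the size of \<open>?M\<close>.\<close>
    have "L2_fixed \<sigma> k = (*v) U ` ?E"
    proof (intro subset_antisym subsetI)
      fix f assume "f \<in> L2_fixed \<sigma> k"
      then have "U' *v f \<in> ?E" using fixed by blast
      moreover have "f = U *v (U' *v f)" by (simp add: matrix_vector_mul_assoc UU)
      ultimately show "f \<in> (*v) U ` ?E" by blast
    next
      fix f assume "f \<in> (*v) U ` ?E"
      then obtain g where g: "g \<in> ?E" and f: "f = U *v g" by (rule imageE)
      have "U' *v f \<in> ?E" unfolding f inverse by (rule g)
      then show "f \<in> L2_fixed \<sigma> k" by (rule fixed[THEN iffD2])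
    qed
    moreover have "vec.dim ((*v) U ` ?E) = vec.dim ?E"
      by (rule vec.dim_image_eq[OF matrix_vector_mul_linear_gen])
        (rule inj_on_inverseI[of _ "(*v) U'"], rule inverse)
    ultimately have "vec.dim (L2_fixed \<sigma> k) = vec.dim ?E" by (simp only:)
    also have "\<dots> = card (- ?T)" by (rule dim_substandard_cart)
    finally have "vec.dim (L2_fixed \<sigma> k) = card (- ?T)" .
    then show ?thesis
      using card_mono[of UNIV ?T] by (simp add: vec_dim_card Compl_eq_Diff_UNIV card_Diff_subset del: vec.dim_UNIV)
  qed
  ultimately show False using nosym by blast
qed

end
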